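(* Let $n$ and $k$ be integers with $0\le k\le n$, let $P_n$ be the $n$-th Legendre polynomial, and let $L$ be the differential operator \[ L=\frac{\mathrm{d}^k}{\mathrm{d}x^k}\,(x^2-1)^k\,\frac{\mathrm{d}^k}{\mathrm{d}x^k}. \] Then \[ L[P_n]=\frac{(n+k)!}{(n-k)!}\,P_n . \]
   Context: The operator $L$ is a composition: $L[f]=\frac{\mathrm{d}^k}{\mathrm{d}x^k}\Bigl((x^2-1)^k\,\frac{\mathrm{d}^k f}{\mathrm{d}x^k}\Bigr)$, i.e. differentiate $k$ times, multiply by $(x^2-1)^k$, then differentiate $k$ times again. The Legendre polynomial is given by Rodrigues' formula $P_n(x)=\frac{1}{2^n n!}\frac{\mathrm{d}^n}{\mathrm{d}x^n}(x^2-1)^n$. *)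

theory Defs
  imports "HOL-Analysis.Analysis"
begin

text \<open>Legendre polynomial, as a real function, by Rodrigues' formula.\<close>

definition legendre :: "nat \<Rightarrow> real \<Rightarrow> real" where
  "legendre n x = 1 / (2 ^ n * fact n) * (deriv ^^ n) (\<lambda>t. (t\<^sup>2 - 1) ^ n) x"

text \<open>
  The composition \<open>d\<^sup>k/dx\<^sup>k \<circ> (x\<^sup>2 - 1)\<^sup>k \<circ> d\<^sup>k/dx\<^sup>k\<close>, where the middle factor is
  multiplication by \<open>(x\<^sup>2 - 1)\<^sup>k\<close>. Since \<^const>\<open>deriv\<close> is total, the definition
  carries its intended meaning only for sufficiently differentiable \<open>f\<close>.
\<close>

definition diff_op :: "nat \<Rightarrow> (real \<Rightarrow> real) \<Rightarrow> real \<Rightarrow> real" where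
  "diff_op k f = (deriv ^^ k) (\<lambda>x. (x\<^sup>2 - 1) ^ k * (deriv ^^ k) f x)"

end

theory Submission
  imports Defs
begin

text \<open>
  Write \<open>q = x\<^sup>2 - 1\<close> and \<open>y\<^sub>j\<close> for the \<open>j\<close>-th derivative of \<open>q\<^sup>n\<close>. Differentiating
  \<open>q y\<^sub>1 = 2 n x y\<^sub>0\<close> gives a three-term recurrence for the \<open>y\<^sub>j\<close>, which is invariant under
  reflecting the index at \<open>n\<close>. Hence \<open>q\<^sup>k y\<^bsub>n+k\<^esub> = (n+k)!/(n-k)! y\<^bsub>n-k\<^esub>\<close>, and differentiating
  this identity \<open>k\<close> times is the claim.
\<close>

lemma deriv_iterate_poly: "(deriv ^^ k) (poly p) = poly ((pderiv ^^ k) p)"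
  for p :: "real poly"
proof (induction k)
  case (Suc k)
  have "deriv (poly r) = poly (pderiv r)" for r :: "real poly"
    by (rule ext) (rule DERIV_imp_deriv, rule poly_DERIV)
  with Suc show ?case by simp
qed simp

lemma pderiv_iterate_smult: "(pderiv ^^ k) (smult c p) = smult c ((pderiv ^^ k) p)"
  by (induction k) (simp_all add: pderiv_smult)

text \<open>Formal polynomials make every derivative free of differentiability side conditions. The
  normalising constant is left out because all identities below are linear.\<close>

definition rodrigues :: "nat \<Rightarrow> nat \<Rightarrow> real poly" where
  "rodrigues n j = (pderiv ^^ j) ([:-1, 0, 1:] ^ n)"

lemma pderiv_rodrigues: "pderiv (rodrigues n j) = rodrigues n (Suc j)"
  by (simp add: rodrigues_def)

lemma legendre_eq_poly: "legendre n = poly (smult (1 / (2 ^ n * fact n)) (rodrigues n n))"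
proof
  fix x
  have "(\<lambda>t::real. (t\<^sup>2 - 1) ^ n) = poly ([:-1, 0, 1:] ^ n)"
    by (simp add: fun_eq_iff power2_eq_square)
  then show "legendre n x = poly (smult (1 / (2 ^ n * fact n)) (rodrigues n n)) x"
    by (simp add: legendre_def rodrigues_def deriv_iterate_poly)
qed

text \<open>The chain rule gives \<open>2 * n * x * q ^ (n - 1)\<close>; the factor \<open>q\<close>
  restores the missing power.\<close>

lemma rodrigues_first_order:
  "[:-1, 0, 1:] * rodrigues n 1 = smult (2 * real n) ([:0, 1:] * rodrigues n 0)"
proof (cases n)
  case 0
  then show ?thesis by (simp add: rodrigues_def)
next
  case (Suc m)
  define q :: "real poly" where "q = [:-1, 0, 1:]"
  have "pderiv q = smult 2 [:0, 1:]"
    by (simp add: q_def pderiv_pCons)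
  then have "pderiv (q ^ n) = smult (2 * real n) ([:0, 1:] * q ^ m)"
    unfolding Suc pderiv_power_Suc by simp
  then show ?thesis
    unfolding rodrigues_def q_def[symmetric] by (simp add: Suc)
qed

text \<open>Induction replaces the Leibniz rule: the derivative of the first-order identity is the
  case \<open>j = 0\<close>, and the derivative of instance \<open>j\<close> is instance
  \<open>Suc j\<close>.\<close>

lemma rodrigues_recurrence:
  "[:-1, 0, 1:] * rodrigues n (Suc (Suc j))
    + smult (2 * (real j + 1 - real n)) ([:0, 1:] * rodrigues n (Suc j))
    + smult ((real j + 1) * (real j - 2 * real n)) (rodrigues n j) = 0"
proof (induction j)
  case 0
  have "pderiv ([:-1, 0, 1:] * rodrigues n 1) = pderiv (smult (2 * real n) ([:0, 1:] * rodrigues n 0))"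
    by (simp only: rodrigues_first_order)
  then show ?case
    by (simp add: poly_eq_poly_eq_iff[symmetric] fun_eq_iff pderiv_mult pderiv_smult pderiv_pCons
        pderiv_diff pderiv_rodrigues algebra_simps)
next
  case (Suc j)
  from arg_cong[OF Suc, of pderiv] show ?case
    by (simp add: poly_eq_poly_eq_iff[symmetric] fun_eq_iff pderiv_mult pderiv_smult pderiv_pCons
        pderiv_add pderiv_diff pderiv_rodrigues algebra_simps)
qed

lemma poly_rodrigues_recurrence:
  "(x\<^sup>2 - 1) * poly (rodrigues n (Suc (Suc j))) x
    = 2 * (real n - real j - 1) * x * poly (rodrigues n (Suc j)) x
      + (real j + 1) * (2 * real n - real j) * poly (rodrigues n j) x"
  using arg_cong[OF rodrigues_recurrence[of n j], of "\<lambda>p. poly p x"]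
  by (simp add: power2_eq_square algebra_simps)

lemma rodrigues_reflection:
  assumes "k \<le> n"
  shows "(x\<^sup>2 - 1) ^ k * poly (rodrigues n (n + k)) x
    = fact (n + k) / fact (n - k) * poly (rodrigues n (n - k)) x"
  using assms
proof (induction k rule: induct_nat_012)
  case 0
  then show ?case by simp
next
  case 1
  \<comment> \<open>At index \<open>n - 1\<close> the middle coefficient of the recurrence vanishes,
    which leaves \<open>q\<close> times entry \<open>n + 1\<close> as \<open>n * (n + 1)\<close>
    times entry \<open>n - 1\<close>.\<close>
  then obtain m where "n = Suc m" by (cases n) auto
  then show ?case
    using poly_rodrigues_recurrence[of x n m] by (simp add: field_simps)
next
  case (ge2 k)
  \<comment> \<open>The reflected indices become \<open>m + 2\<close>, \<open>m + 1\<close> and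
    \<open>m\<close>, free of truncated subtraction.\<close>
  then obtain m where n: "n = m + k + 2" by (metis add.commute add.assoc le_Suc_ex add_2_eq_Suc)
  define Y where "Y j = poly (rodrigues n j) x" for j
  define A where "A = (fact (n + k) / fact (m + 2) :: real)"
  define B where "B = (fact (n + k + 1) / fact (m + 1) :: real)"
  define w where "w = x\<^sup>2 - 1"
  have B: "B = A * (real n + real k + 1) * (real m + 2)"
    using fact_Suc[of "n + k", where 'a = real] fact_Suc[of "m + 1", where 'a = real]
    unfolding A_def B_def by (simp add: divide_simps add_ac del: fact_Suc)
  have C: "fact (n + k + 2) / fact m = B * (real n + real k + 2) * (real m + 1)"
    using fact_Suc[of "n + k + 1", where 'a = real] fact_Suc[of m, where 'a = real]
    unfolding B_def by (simp add: divide_simps add_ac del: fact_Suc)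
  have IH0: "w ^ k * Y (n + k) = A * Y (m + 2)" and IH1: "w ^ (k + 1) * Y (n + k + 1) = B * Y (m + 1)"
    using ge2 n by (simp_all add: A_def B_def Y_def w_def)
  \<comment> \<open>The recurrence at \<open>n + k\<close> and at its mirror position
    \<open>m\<close> has middle coefficients that differ only in sign.\<close>
  have up: "w * Y (n + k + 2) = - 2 * (real k + 1) * x * Y (n + k + 1)
      + (real n + real k + 1) * (real m + 2) * Y (n + k)"
    using poly_rodrigues_recurrence[of x n "n + k"] by (simp add: Y_def w_def n algebra_simps)
  have down: "w * Y (m + 2) = 2 * (real k + 1) * x * Y (m + 1)
      + (real m + 1) * (real n + real k + 2) * Y m"
    using poly_rodrigues_recurrence[of x n m] by (simp add: Y_def w_def n algebra_simps)
  have "w ^ (k + 2) * Y (n + k + 2) = w ^ (k + 1) * (w * Y (n + k + 2))"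
    by simp
  also have "\<dots> = - 2 * (real k + 1) * x * (w ^ (k + 1) * Y (n + k + 1))
      + (real n + real k + 1) * (real m + 2) * w * (w ^ k * Y (n + k))"
    unfolding up by (simp add: algebra_simps)
  \<comment> \<open>The outer coefficient turns \<open>A\<close> into \<open>B\<close>, so
    \<open>B\<close> factors out and the bracket is what \<open>down\<close> evaluates.\<close>
  also have "\<dots> = B * (w * Y (m + 2) - 2 * (real k + 1) * x * Y (m + 1))"
    unfolding IH0 IH1 B by (simp add: algebra_simps)
  also have "\<dots> = B * (real n + real k + 2) * (real m + 1) * Y m"
    unfolding down by simp
  finally show ?case
    unfolding C[symmetric] by (simp add: Y_def w_def n)
qed

theorem corollary4p7:
  fixes n k :: nat
  assumes "k \<le> n"
  shows "diff_op k (legendre n) = (\<lambda>x. fact (n + k) / fact (n - k) * legendre n x)"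
proof -
  define c :: real where "c = 1 / (2 ^ n * fact n)"
  define r :: real where "r = fact (n + k) / fact (n - k)"
  have "(pderiv ^^ k) (smult c (rodrigues n n)) = smult c (rodrigues n (n + k))"
    by (simp add: pderiv_iterate_smult rodrigues_def funpow_add add.commute)
  \<comment> \<open>By reflection the inner function is a multiple of entry \<open>n - k\<close>,
    which the outer \<open>k\<close> derivatives carry back to entry \<open>n\<close>.\<close>
  then have "(\<lambda>x. (x\<^sup>2 - 1) ^ k * (deriv ^^ k) (legendre n) x)
      = poly (smult (r * c) (rodrigues n (n - k)))"
    using rodrigues_reflection[OF assms]
    by (simp add: legendre_eq_poly deriv_iterate_poly fun_eq_iff c_def r_def mult.left_commute)
  then have "diff_op k (legendre n) = poly (smult (r * c) ((pderiv ^^ k) (rodrigues n (n - k))))"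
    by (simp only: diff_op_def deriv_iterate_poly pderiv_iterate_smult)
  also have "(pderiv ^^ k) (rodrigues n (n - k)) = rodrigues n n"
    using assms by (simp add: rodrigues_def flip: funpow_add[THEN fun_cong, unfolded comp_apply])
  finally have "diff_op k (legendre n) x = r * poly (smult c (rodrigues n n)) x" for x
    by simp
  then show ?thesis
    by (intro ext) (simp only: legendre_eq_poly c_def r_def)
qed

end
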